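(* Let $H$ be a non-empty 3-graph (one having at least one 3-edge), and let $F(H)$ be the co-spanned $H$. Then \[\gamma(F(H))\leq \frac{1}{2-\gamma(H)},\] where $\gamma$ denotes codegree density.
   Context: A 3-graph is a pair $G=(V,E)$ with $V$ a finite vertex set and $E$ a set of 3-element subsets of $V$ (the 3-edges). A 3-graph contains another 3-graph $F$ as a subgraph if it has a (not necessarily induced) subgraph isomorphic to $F$. Given a 3-graph $H$, the co-spanned $H$, denoted $F(H)$, is the 3-graph with vertex set $V(H)\sqcup\{x_\star,y_\star\}$ and 3-edge set $\{x_\star y_\star v: v\in V(H)\}\sqcup E(H)$. For a family $\mathcal{F}$ of non-empty 3-graphs, the codegree threshold $\mathrm{coex}(n,\mathcal{F})$ is the largest integer $d$ such that there exists an $n$-vertex 3-graph in which every pair of distinct vertices is contained in at least $d$ 3-edges and which contains no member of $\mathcal{F}$ as a subgraph. The codegree density of $\mathcal{F}$ is $\gamma(\mathcal{F})=\lim_{n\to\infty}\frac{\mathrm{coex}(n,\mathcal{F})}{n-2}$; this limit is known to exist for every such $\mathcal{F}$ (Mubayi and Zhao). For a single 3-graph $F$, write $\gamma(F)=\gamma(\{F\})$. *)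

theory Defs
  imports "HOL-Analysis.Analysis"
begin

record 'a hypergraph =
  verts :: "'a set"
  edges :: "'a set set"

definition three_graph :: "'a hypergraph \<Rightarrow> bool" where
  "three_graph G \<longleftrightarrow> finite (verts G) \<and> (\<forall>e\<in>edges G. e \<subseteq> verts G \<and> card e = 3)"

definition subgraph :: "'a hypergraph \<Rightarrow> 'a hypergraph \<Rightarrow> bool" where
  "subgraph S G \<longleftrightarrow> three_graph S \<and> verts S \<subseteq> verts G \<and> edges S \<subseteq> edges G"

definition isomorphic :: "'a hypergraph \<Rightarrow> 'b hypergraph \<Rightarrow> bool" where
  "isomorphic F S \<longleftrightarrow>
     (\<exists>\<phi>. bij_betw \<phi> (verts F) (verts S) \<and> edges S = (\<lambda>e. \<phi> ` e) ` edges F)"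

definition contains :: "'b hypergraph \<Rightarrow> 'a hypergraph \<Rightarrow> bool" where
  "contains G F \<longleftrightarrow> (\<exists>S. subgraph S G \<and> isomorphic F S)"

datatype 'a cospan_vertex = Base 'a | XStar | YStar

definition co_spanned :: "'a hypergraph \<Rightarrow> 'a cospan_vertex hypergraph" where
  "co_spanned H =
     \<lparr> verts = Base ` verts H \<union> {XStar, YStar},
       edges = {{XStar, YStar, Base v} | v. v \<in> verts H} \<union> (\<lambda>e. Base ` e) ` edges H \<rparr>"

definition codegree :: "'a hypergraph \<Rightarrow> 'a \<Rightarrow> 'a \<Rightarrow> nat" where
  "codegree G u v = card {e \<in> edges G. {u, v} \<subseteq> e}"

(* Host graphs may be taken on vertices of type nat, since every finite 3-graph is isomorphic
   to one of these. For n >= 2 and a family of non-empty 3-graphs the set below is finite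
   (it is bounded by n - 2) and contains 0 (take the host without edges), so d may range over nat.
   For n < 2 there are no pairs of distinct vertices and the value is irrelevant to the limit. *)
definition coex :: "nat \<Rightarrow> 'a hypergraph set \<Rightarrow> nat" where
  "coex n \<F> = Max {d. \<exists>G :: nat hypergraph. three_graph G \<and> card (verts G) = n \<and>
       (\<forall>u\<in>verts G. \<forall>v\<in>verts G. u \<noteq> v \<longrightarrow> d \<le> codegree G u v) \<and>
       (\<forall>F\<in>\<F>. \<not> contains G F)}"

definition codegree_density :: "'a hypergraph set \<Rightarrow> real" where
  "codegree_density \<F> = lim (\<lambda>n. real (coex n \<F>) / (real n - 2))"

end

theory Submission
  imports Defs "HOL-Real_Asymp.Real_Asymp"
begin

text \<open>
  If \<open>G\<close> has no copy of \<open>F(H)\<close>, then the set \<open>W\<close> of common neighbours of any pair induces an \<open>H\<close>-free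
  3-graph, so some pair \<open>u v\<close> in \<open>W\<close> has at most about \<open>\<gamma>(H) |W|\<close> common neighbours inside \<open>W\<close>.
  Its common neighbourhood and \<open>W\<close> both have size at least the minimum codegree \<open>d\<close>, and their union
  has size at most \<open>n\<close>, whence \<open>d (2 - \<gamma>(H))\<close> is at most about \<open>n\<close>.

  Since \<^const>\<open>codegree_density\<close> is a \<^const>\<open>lim\<close>, the existence of the limit has to be shown as well:
  a random map from \<open>m\<close> points into a huge extremal 3-graph is injective and keeps all relative
  codegrees up to \<open>\<epsilon>\<close> with positive probability, so the ratios are almost decreasing.
\<close>

section \<open>Tail bound for random maps and a convergence criterion\<close>

text \<open>A Chernoff bound for uniformly random maps, by counting with the weight \<open>exp (- s)\<close> per hit,
  \<open>s = \<epsilon> / 2\<close>.\<close>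

lemma card_PiE_few_hits_le:
  fixes p \<epsilon> :: real
  assumes I: "finite I" and V: "finite V" "N \<subseteq> V" and N: "p * card V \<le> card N"
    and p: "0 \<le> p" "p \<le> 1" and \<epsilon>: "0 < \<epsilon>"
  shows "card {f \<in> I \<rightarrow>\<^sub>E V. card {k\<in>I. f k \<in> N} < (p - \<epsilon>) * card I}
           \<le> real (card V) ^ card I * exp (- \<epsilon>\<^sup>2 / 4 * card I)"
proof -
  define s where "s = \<epsilon> / 2"
  have s: "s > 0" using \<epsilon> by (simp add: s_def)
  define w where "w v = (if v \<in> N then exp (- s) else 1)" for v
  let ?B = "{f \<in> I \<rightarrow>\<^sub>E V. card {k\<in>I. f k \<in> N} < (p - \<epsilon>) * card I}"
  let ?a = "(p - \<epsilon>) * card I"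
  have finN: "finite N" using V finite_subset by blast
  have finP: "finite (I \<rightarrow>\<^sub>E V)" using I V by (simp add: finite_PiE)
  \<comment> \<open>Multiplying the weights over all coordinates records the number of hits in the
    exponent, so a map with few hits carries a large weight.\<close>
  have prod_w: "(\<Prod>k\<in>I. w (f k)) = exp (- s * card {k\<in>I. f k \<in> N})" for f
  proof -
    have "(\<Prod>k\<in>I. w (f k)) = (\<Prod>k\<in>{k\<in>I. f k \<in> N}. exp (- s))"
      unfolding w_def by (rule prod.inter_filter[OF I, symmetric])
    also have "\<dots> = exp (- s) ^ card {k\<in>I. f k \<in> N}" by simp
    also have "\<dots> = exp (- s * card {k\<in>I. f k \<in> N})"
      by (simp add: exp_of_nat_mult[symmetric] mult.commute)
    finally show ?thesis .
  qed
  \<comment> \<open>The total weight of \<open>V\<close> is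
    \<open>card V - card N * (1 - exp (- s))\<close>; the bounds
    \<open>s - s\<^sup>2 \<le> 1 - exp (- s)\<close> and \<open>1 + x \<le> exp x\<close> make it
    exponential.\<close>
  have sum_w: "(\<Sum>v\<in>V. w v) \<le> card V * exp (- p * (s - s\<^sup>2))"
  proof -
    have "(\<Sum>v\<in>V. w v) = (\<Sum>v\<in>V. 1 - (if v \<in> N then 1 - exp (- s) else 0))"
      by (intro sum.cong) (auto simp: w_def)
    also have "\<dots> = card V - card N * (1 - exp (- s))"
    proof -
      have "V \<inter> N = N" using V by auto
      then show ?thesis using V by (simp add: sum_subtractf sum.If_cases)
    qed
    also have "\<dots> \<le> card V - p * card V * (s - s\<^sup>2)"
    proof -
      have "exp (- s) \<le> 1 / (1 + s)"
        using exp_ge_add_one_self[of s] s by (simp add: exp_minus field_simps del: exp_ge_add_one_self)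
      also have "1 / (1 + s) \<le> 1 - (s - s\<^sup>2)"
        using s by (simp add: field_simps power2_eq_square)
      finally have "s - s\<^sup>2 \<le> 1 - exp (- s)" by simp
      then have "p * card V * (s - s\<^sup>2) \<le> p * card V * (1 - exp (- s))"
        using p by (intro mult_left_mono) auto
      also have "\<dots> \<le> card N * (1 - exp (- s))"
        using N s by (intro mult_right_mono) auto
      finally show ?thesis by simp
    qed
    also have "\<dots> = card V * (1 + (- p * (s - s\<^sup>2)))" by (simp add: algebra_simps)
    also have "\<dots> \<le> card V * exp (- p * (s - s\<^sup>2))"
      by (intro mult_left_mono exp_ge_add_one_self) auto
    finally show ?thesis .
  qed
  \<comment> \<open>Markov's inequality in counting form: every map in \<open>?B\<close> has weight
    at least \<open>exp (- s * ?a)\<close>, and the total weight of all maps factorises over the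
    coordinates.\<close>
  have "card ?B * exp (- s * ?a) = (\<Sum>f\<in>?B. exp (- s * ?a))" by simp
  also have "\<dots> \<le> (\<Sum>f\<in>?B. \<Prod>k\<in>I. w (f k))"
    using s by (intro sum_mono) (auto simp: prod_w)
  also have "\<dots> \<le> (\<Sum>f\<in>I \<rightarrow>\<^sub>E V. \<Prod>k\<in>I. w (f k))"
    using finP by (intro sum_mono2) (auto simp: w_def intro!: prod_nonneg)
  also have "\<dots> = (\<Prod>k\<in>I. \<Sum>v\<in>V. w v)"
    using I V by (subst prod_sum_PiE) auto
  also have "\<dots> = (\<Sum>v\<in>V. w v) ^ card I" by simp
  also have "\<dots> \<le> (card V * exp (- p * (s - s\<^sup>2))) ^ card I"
    using sum_w by (intro power_mono) (auto simp: w_def intro!: sum_nonneg)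
  also have "\<dots> = card V ^ card I * exp (- p * (s - s\<^sup>2) * card I)"
    by (simp add: power_mult_distrib exp_of_nat_mult[symmetric] mult.commute)
  finally have "card ?B * exp (- s * ?a) * exp (s * ?a)
      \<le> card V ^ card I * exp (- p * (s - s\<^sup>2) * card I) * exp (s * ?a)"
    by (intro mult_right_mono) auto
  then have "card ?B \<le> card V ^ card I * exp (- p * (s - s\<^sup>2) * card I + s * ?a)"
    by (simp add: mult.assoc exp_add[symmetric])
  \<comment> \<open>With \<open>\<epsilon> = 2 * s\<close> the exponent per coordinate is
    \<open>(p - 2) * s\<^sup>2\<close>, which is at most \<open>- s\<^sup>2\<close> because
    \<open>p \<le> 1\<close>.\<close>
  also have "\<dots> \<le> card V ^ card I * exp (- \<epsilon>\<^sup>2 / 4 * card I)"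
  proof -
    have eps: "\<epsilon> = 2 * s" by (simp add: s_def)
    have "- p * (s - s\<^sup>2) + s * (p - \<epsilon>) = p * s\<^sup>2 - 2 * s\<^sup>2"
      unfolding eps by (simp add: algebra_simps power2_eq_square)
    also have "\<dots> \<le> - \<epsilon>\<^sup>2 / 4"
      using mult_right_mono[OF p(2), of "s\<^sup>2"] by (simp add: s_def power_divide)
    finally have "(- p * (s - s\<^sup>2) + s * (p - \<epsilon>)) * card I \<le> - \<epsilon>\<^sup>2 / 4 * card I"
      by (intro mult_right_mono) auto
    then show ?thesis by (intro mult_left_mono) (auto simp: algebra_simps)
  qed
  finally show ?thesis by simp
qed

text \<open>Bolzano-Weierstrass supplies a subsequence with limit \<open>l\<close>. Every late term
  is bounded above through a fixed subsequence term and below through one far enough out, so all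
  late terms are near \<open>l\<close>.\<close>

lemma convergent_if_almost_decreasing:
  fixes a :: "nat \<Rightarrow> real"
  assumes "Bseq a"
    and dec: "\<And>\<epsilon>. \<epsilon> > 0 \<Longrightarrow> \<exists>m0. \<forall>m\<ge>m0. \<exists>n0. \<forall>n\<ge>n0. a n \<le> a m + \<epsilon>"
  shows "convergent a"
proof -
  obtain l r where r: "strict_mono r" and l: "(a \<circ> r) \<longlonglongrightarrow> l"
    using bounded_imp_convergent_subsequence[of a] assms(1) by (auto simp: Bseq_eq_bounded)
  have "a \<longlonglongrightarrow> l"
  proof (rule LIMSEQ_I)
    fix e :: real assume "e > 0"
    then have e: "e / 3 > 0" by simp
    obtain m0 where m0: "\<And>m. m \<ge> m0 \<Longrightarrow> \<exists>n0. \<forall>n\<ge>n0. a n \<le> a m + e / 3"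
      using dec[OF e] by blast
    obtain K where K: "\<And>k. k \<ge> K \<Longrightarrow> \<bar>a (r k) - l\<bar> < e / 3"
      using LIMSEQ_D[OF l e] by auto
    define k where "k = max K m0"
    have "r k \<ge> m0" using seq_suble[OF r, of k] by (simp add: k_def)
    then obtain n0 where n0: "\<And>n. n \<ge> n0 \<Longrightarrow> a n \<le> a (r k) + e / 3" using m0 by blast
    have "norm (a n - l) < e" if n: "n \<ge> max n0 m0" for n
    proof -
      obtain n1 where n1: "\<And>n'. n' \<ge> n1 \<Longrightarrow> a n' \<le> a n + e / 3" using m0 n by force
      have "r (max K n1) \<ge> n1" using seq_suble[OF r, of "max K n1"] by simp
      then have "a (r (max K n1)) \<le> a n + e / 3" by (rule n1)
      moreover have "a n \<le> a (r k) + e / 3" using n0 n by simp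
      moreover have "\<bar>a (r k) - l\<bar> < e / 3" "\<bar>a (r (max K n1)) - l\<bar> < e / 3"
        using K by (simp_all add: k_def)
      ultimately show ?thesis unfolding real_norm_def by linarith
    qed
    then show "\<exists>no. \<forall>n\<ge>no. norm (a n - l) < e" by blast
  qed
  then show ?thesis by (rule convergentI)
qed

section \<open>Links, induced 3-graphs and the maximum defining \<open>coex\<close>\<close>

definition codegree_host :: "'a hypergraph \<Rightarrow> nat \<Rightarrow> nat \<Rightarrow> nat hypergraph \<Rightarrow> bool" where
  "codegree_host F n d G \<longleftrightarrow> three_graph G \<and> card (verts G) = n \<and>
     (\<forall>u\<in>verts G. \<forall>v\<in>verts G. u \<noteq> v \<longrightarrow> d \<le> codegree G u v) \<and> \<not> contains G F"

definition link :: "'a hypergraph \<Rightarrow> 'a \<Rightarrow> 'a \<Rightarrow> 'a set" where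
  "link G u v = {w. {u, v, w} \<in> edges G}"

definition induced :: "'a hypergraph \<Rightarrow> 'a set \<Rightarrow> 'a hypergraph" where
  "induced G W = \<lparr>verts = W, edges = {e \<in> edges G. e \<subseteq> W}\<rparr>"

text \<open>A triple with a repeated vertex has fewer than three elements, hence is no
  3-edge.\<close>

lemma link_not_endpoint:
  assumes "three_graph G" "w \<in> link G u v"
  shows "u \<noteq> v" "w \<noteq> u" "w \<noteq> v"
proof -
  have "card {u, v, w} = 3" using assms by (auto simp: three_graph_def link_def)
  then show "u \<noteq> v" "w \<noteq> u" "w \<noteq> v" by (auto simp: card_insert_if split: if_splits)
qed

lemma link_subset: "three_graph G \<Longrightarrow> link G u v \<subseteq> verts G - {u, v}"
  using link_not_endpoint[of G _ u v] by (auto simp: three_graph_def link_def)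

lemma finite_link: "three_graph G \<Longrightarrow> finite (link G u v)"
  using link_subset[of G u v] by (auto simp: three_graph_def dest: finite_subset)

text \<open>A 3-edge through \<open>u\<close> and \<open>v\<close> is determined by its third
  vertex.\<close>

lemma codegree_eq_card_link:
  assumes G: "three_graph G" and uv: "u \<noteq> v"
  shows "codegree G u v = card (link G u v)"
proof -
  have "bij_betw (\<lambda>w. {u, v, w}) (link G u v) {e \<in> edges G. {u, v} \<subseteq> e}"
    unfolding bij_betw_def
  proof
    show "inj_on (\<lambda>w. {u, v, w}) (link G u v)"
    proof (rule inj_onI)
      fix w z assume "w \<in> link G u v" "z \<in> link G u v" "{u, v, w} = {u, v, z}"
      then have "w \<in> {u, v, z}" "w \<noteq> u" "w \<noteq> v"
        using link_not_endpoint[OF G, of w u v] by blast+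
      then show "w = z" by blast
    qed
    show "(\<lambda>w. {u, v, w}) ` link G u v = {e \<in> edges G. {u, v} \<subseteq> e}"
    proof (intro equalityI subsetI)
      fix e assume e: "e \<in> {e \<in> edges G. {u, v} \<subseteq> e}"
      then have "card e = 3" using G by (auto simp: three_graph_def)
      then have "card (e - {u, v}) = 1" using e uv by (subst card_Diff_subset) auto
      then obtain w where "e - {u, v} = {w}" by (auto simp: card_1_singleton_iff)
      then have "e = {u, v, w}" using e by auto
      then show "e \<in> (\<lambda>w. {u, v, w}) ` link G u v" using e by (auto simp: link_def)
    qed (auto simp: link_def)
  qed
  then show ?thesis by (simp add: codegree_def bij_betw_same_card)
qed

lemma three_graph_induced: "three_graph G \<Longrightarrow> W \<subseteq> verts G \<Longrightarrow> three_graph (induced G W)"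
  by (auto simp: three_graph_def induced_def intro: finite_subset)

lemma codegree_induced:
  assumes "three_graph G" "W \<subseteq> verts G" "u \<in> W" "v \<in> W" "u \<noteq> v"
  shows "codegree (induced G W) u v = card (link G u v \<inter> W)"
proof -
  have "link (induced G W) u v = link G u v \<inter> W"
    using assms by (auto simp: link_def induced_def)
  then show ?thesis using codegree_eq_card_link[OF three_graph_induced] assms by metis
qed

lemma contains_induced:
  assumes "contains (induced G W) F" "W \<subseteq> verts G" shows "contains G F"
  using assms unfolding contains_def subgraph_def induced_def by fastforce

lemma codegree_le:
  assumes "three_graph G" "u \<in> verts G" "v \<in> verts G" "u \<noteq> v"
  shows "codegree G u v \<le> card (verts G) - 2"
proof -
  have "finite (verts G)" using assms by (simp add: three_graph_def)
  then have "card (link G u v) \<le> card (verts G - {u, v})"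
    using link_subset[OF assms(1)] by (intro card_mono) auto
  also have "\<dots> = card (verts G) - 2" using assms by (subst card_Diff_subset) auto
  finally show ?thesis using codegree_eq_card_link assms by metis
qed

text \<open>This makes the set under the maximum finite. With fewer than two vertices the codegree
  condition is vacuous and bounds nothing.\<close>

lemma codegree_host_le:
  assumes "codegree_host F n d G" "n \<ge> 2" shows "d \<le> n - 2"
proof -
  have G: "three_graph G" "card (verts G) = n" using assms by (auto simp: codegree_host_def)
  then have "\<exists>u\<in>verts G. \<exists>v\<in>verts G. u \<noteq> v"
    using assms(2) card_2_iff'[of "verts G"] card_le_Suc0_iff_eq[of "verts G"]
    by (auto simp: three_graph_def)
  then obtain u v where "u \<in> verts G" "v \<in> verts G" "u \<noteq> v" by blast
  then show ?thesis
    using codegree_le[OF G(1), of u v] assms G(2) unfolding codegree_host_def by fastforce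
qed

lemma coex_singleton: "coex n {F} = Max {d. \<exists>G. codegree_host F n d G}"
  by (simp add: coex_def codegree_host_def)

lemma finite_codegree_hosts: "n \<ge> 2 \<Longrightarrow> finite {d. \<exists>G. codegree_host F n d G}"
  by (rule finite_subset[of _ "{..n - 2}"]) (auto dest: codegree_host_le)

text \<open>The edgeless host shows that the set under the maximum is not empty.\<close>

lemma codegree_host_zero:
  assumes "edges F \<noteq> {}"
  shows "codegree_host F n 0 \<lparr>verts = {..<n}, edges = {}\<rparr>"
  using assms by (auto simp: codegree_host_def three_graph_def contains_def subgraph_def isomorphic_def)

lemma coex_attained:
  assumes "edges F \<noteq> {}" "n \<ge> 2"
  obtains G where "codegree_host F n (coex n {F}) G"
proof -
  have "coex n {F} \<in> {d. \<exists>G. codegree_host F n d G}"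
    unfolding coex_singleton using assms codegree_host_zero finite_codegree_hosts
    by (intro Max_in) blast+
  then show ?thesis using that by blast
qed

lemma coex_ge: "codegree_host F n d G \<Longrightarrow> n \<ge> 2 \<Longrightarrow> d \<le> coex n {F}"
  unfolding coex_singleton using finite_codegree_hosts by (intro Max_ge) blast+

lemma coex_le: "edges F \<noteq> {} \<Longrightarrow> n \<ge> 2 \<Longrightarrow> coex n {F} \<le> n - 2"
  using coex_attained codegree_host_le by metis

section \<open>Sparse pairs and the embedding of the co-spanned 3-graph\<close>

text \<open>By maximality of \<open>coex\<close>, the codegrees of the induced 3-graph cannot all be
  at least \<open>coex (card W) {F} + 1\<close>.\<close>

lemma exists_sparse_pair:
  fixes G :: "nat hypergraph"
  assumes F: "edges F \<noteq> {}" and G: "three_graph G" "W \<subseteq> verts G" "2 \<le> card W"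
    and free: "\<not> contains (induced G W) F"
  obtains u v where "u \<in> W" "v \<in> W" "u \<noteq> v" "card (link G u v \<inter> W) \<le> coex (card W) {F}"
proof -
  have "\<not> codegree_host F (card W) (Suc (coex (card W) {F})) (induced G W)"
    using coex_ge[of F "card W" "Suc (coex (card W) {F})"] G(3) by fastforce
  then obtain u v where "u \<in> W" "v \<in> W" "u \<noteq> v"
    "\<not> Suc (coex (card W) {F}) \<le> codegree (induced G W) u v"
    using three_graph_induced[OF G(1,2)] free by (auto simp: codegree_host_def induced_def)
  then show ?thesis using that codegree_induced[OF G(1,2)] by fastforce
qed

text \<open>Every vertex of a copy of \<open>H\<close> inside the link of \<open>x\<close> and
  \<open>y\<close> forms a 3-edge with that pair, so \<open>x\<close> and \<open>y\<close> can serve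
  as the two star vertices.\<close>

lemma contains_co_spanned:
  assumes G: "three_graph G" and H: "contains (induced G (link G x y)) H"
    and xy: "x \<in> verts G" "y \<in> verts G" "x \<noteq> y" and tH: "three_graph H"
  shows "contains G (co_spanned H)"
proof -
  obtain S \<phi> where S: "subgraph S (induced G (link G x y))"
    and \<phi>: "bij_betw \<phi> (verts H) (verts S)" "edges S = (\<lambda>e. \<phi> ` e) ` edges H"
    using H by (auto simp: contains_def isomorphic_def)
  define \<psi> where "\<psi> c = (case c of Base v \<Rightarrow> \<phi> v | XStar \<Rightarrow> x | YStar \<Rightarrow> y)" for c
  have \<psi>: "\<psi> (Base v) = \<phi> v" "\<psi> XStar = x" "\<psi> YStar = y" "\<psi> ` Base ` A = \<phi> ` A" for v A
    by (auto simp: \<psi>_def image_image)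
  have vS: "verts S = \<phi> ` verts H" using \<phi>(1) by (simp add: bij_betw_def)
  have SL: "verts S \<subseteq> link G x y" using S by (simp add: subgraph_def induced_def)
  have eS: "edges S \<subseteq> edges G" "\<And>e. e \<in> edges S \<Longrightarrow> e \<subseteq> verts S"
    using S by (auto simp: subgraph_def induced_def three_graph_def)
  \<comment> \<open>Taking the edges of \<open>T\<close> as an image settles the edge part of the
    isomorphism at once; \<open>eT\<close> then gives the explicit form that shows \<open>T\<close>
    to lie in \<open>G\<close>.\<close>
  define T where "T = \<lparr>verts = verts S \<union> {x, y}, edges = (\<lambda>e. \<psi> ` e) ` edges (co_spanned H)\<rparr>"
  have vT: "verts T = verts S \<union> {x, y}" by (simp add: T_def)
  have eT: "edges T = {{x, y, w} | w. w \<in> verts S} \<union> edges S"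
  proof -
    have "(\<lambda>e. \<psi> ` e) ` {{XStar, YStar, Base v} | v. v \<in> verts H} = {{x, y, w} | w. w \<in> verts S}"
      unfolding setcompr_eq_image image_image by (simp add: \<psi> vS image_image)
    then show ?thesis by (simp add: T_def co_spanned_def image_Un image_image \<psi> \<phi>(2))
  qed
  have "verts T \<subseteq> verts G" using SL link_subset[OF G, of x y] xy by (auto simp: T_def)
  moreover have "edges T \<subseteq> edges G" using SL eS by (auto simp: eT link_def)
  moreover have "three_graph T"
    unfolding three_graph_def
  proof (intro conjI ballI)
    show "finite (verts T)"
      using \<open>verts T \<subseteq> verts G\<close> G finite_subset by (auto simp: three_graph_def)
    fix e assume e: "e \<in> edges T"
    then show "e \<subseteq> verts T" using eS(2) by (auto simp: eT vT dest: subsetD)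
    show "card e = 3" using e \<open>edges T \<subseteq> edges G\<close> G by (auto simp: three_graph_def)
  qed
  moreover have "bij_betw \<psi> (verts (co_spanned H)) (verts T)"
  proof -
    have "inj_on \<phi> (verts H)" using \<phi>(1) by (simp add: bij_betw_def)
    \<comment> \<open>Vertices of the link differ from \<open>x\<close> and \<open>y\<close>, so the
      extension of \<open>\<phi>\<close> stays injective.\<close>
    moreover have "x \<notin> verts S" "y \<notin> verts S" using SL link_subset[OF G, of x y] by auto
    ultimately have "inj_on \<psi> (verts (co_spanned H))"
      using xy(3) unfolding inj_on_def co_spanned_def by (auto simp: \<psi> vS)
    moreover have "\<psi> ` verts (co_spanned H) = verts T"
      by (simp add: co_spanned_def T_def image_Un \<psi> vS insert_commute)
    ultimately show ?thesis by (simp add: bij_betw_def)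
  qed
  ultimately show ?thesis
    unfolding contains_def subgraph_def isomorphic_def by (intro exI[of _ T]) (auto simp: T_def)
qed

section \<open>Random samples and existence of the limit\<close>

text \<open>Union bound for a uniform map from \<open>m\<close> indices to the vertices: a pair of
  indices is bad if its values collide or if the other indices hit their link too rarely. By
  \<open>small\<close> some map has no bad pair; its image is \<open>W\<close>.\<close>

lemma exists_dense_sample:
  fixes \<epsilon> :: real
  assumes G: "three_graph G" and n: "card (verts G) = n" "0 < n"
    and d: "\<And>u v. u \<in> verts G \<Longrightarrow> v \<in> verts G \<Longrightarrow> u \<noteq> v \<Longrightarrow> d \<le> codegree G u v"
    and "d \<le> n" and \<epsilon>: "0 < \<epsilon>" and m: "2 \<le> m"
    and small: "real (m\<^sup>2) / n + real (m\<^sup>2) * exp (- \<epsilon>\<^sup>2 / 4 * real (m - 2)) < 1"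
  obtains W where "W \<subseteq> verts G" "card W = m"
    "\<And>u v. u \<in> W \<Longrightarrow> v \<in> W \<Longrightarrow> u \<noteq> v \<Longrightarrow> (d / n - \<epsilon>) * real (m - 2) \<le> card (link G u v \<inter> W)"
proof -
  define V where "V = verts G"
  define I where "I = {..<m}"
  define p where "p = d / n"
  let ?\<Omega> = "I \<rightarrow>\<^sub>E V"
  let ?e = "exp (- \<epsilon>\<^sup>2 / 4 * real (m - 2))"
  have finV: "finite V" and cV: "card V = n" and finI: "finite I" and cI: "card I = m"
    using G n by (auto simp: V_def I_def three_graph_def)
  have fin\<Omega>: "finite ?\<Omega>" and c\<Omega>: "card ?\<Omega> = n ^ m"
    using finI finV cV cI by (simp_all add: finite_PiE card_PiE)
  have p: "0 \<le> p" "p \<le> 1" using \<open>d \<le> n\<close> n by (simp_all add: p_def)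
  \<comment> \<open>Only the other \<open>m - 2\<close> indices are counted: their values are
    independent of \<open>f i\<close> and \<open>f j\<close>.\<close>
  define hits where "hits f i j = card {k \<in> I - {i, j}. f k \<in> link G (f i) (f j)}" for f i j
  define Coll where "Coll i j = {f \<in> ?\<Omega>. f i = f j}" for i j
  define Poor where "Poor i j = {f \<in> ?\<Omega>. f i \<noteq> f j \<and> hits f i j < (p - \<epsilon>) * real (m - 2)}" for i j
  \<comment> \<open>In a collision the value at \<open>j\<close> repeats the one at
    \<open>i\<close>, so forgetting \<open>j\<close> is injective and saves a factor
    \<open>n\<close>.\<close>
  have Coll: "card (Coll i j) \<le> n ^ (m - 1)" if ij: "i \<in> I" "j \<in> I" "i \<noteq> j" for i j
  proof -
    have "inj_on (\<lambda>f. restrict f (I - {j})) (Coll i j)"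
    proof (rule inj_onI)
      fix f g assume fg: "f \<in> Coll i j" "g \<in> Coll i j" "restrict f (I - {j}) = restrict g (I - {j})"
      have *: "f k = g k" if "k \<in> I - {j}" for k using fun_cong[OF fg(3), of k] that by simp
      have "f k = g k" if "k \<in> I" for k
        using *[of k] *[of i] fg(1,2) ij that by (cases "k = j") (auto simp: Coll_def)
      then show "f = g" using fg(1,2) by (intro PiE_ext[of f I "\<lambda>_. V"]) (auto simp: Coll_def)
    qed
    moreover have "(\<lambda>f. restrict f (I - {j})) ` Coll i j \<subseteq> (I - {j}) \<rightarrow>\<^sub>E V"
      by (force simp: Coll_def restrict_PiE_iff dest: PiE_mem)
    ultimately have "card (Coll i j) \<le> card ((I - {j}) \<rightarrow>\<^sub>E V)"
      using finI finV by (intro card_inj_on_le) (auto intro: finite_PiE)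
    also have "\<dots> = n ^ (m - 1)" using finI ij cI cV by (simp add: card_PiE card_Diff_singleton)
    finally show ?thesis .
  qed
  \<comment> \<open>Condition on the values at \<open>i\<close> and \<open>j\<close>: their link is
    then a fixed set of density at least \<open>p\<close>, and the tail bound applies to the
    remaining indices.\<close>
  have Poor: "card (Poor i j) \<le> n ^ m * ?e" if ij: "i \<in> I" "j \<in> I" "i \<noteq> j" for i j
  proof -
    let ?J = "I - {i, j}"
    have cJ: "card ?J = m - 2" using ij finI cI by (subst card_Diff_subset) auto
    define Q where "Q = (\<lambda>(x, y). {f \<in> Poor i j. f i = x \<and> f j = y})"
    have Q: "card (Q xy) \<le> n ^ (m - 2) * ?e" if xy: "xy \<in> V \<times> V" for xy
    proof (cases "fst xy = snd xy")
      case True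
      then have "Q xy = {}" by (auto simp: Q_def Poor_def split: prod.splits)
      then show ?thesis by simp
    next
      case False
      obtain x y where xy_eq: "xy = (x, y)" by (cases xy)
      then have xy': "x \<in> V" "y \<in> V" "x \<noteq> y" using xy False by auto
      let ?N = "link G x y"
      let ?B = "{f \<in> ?J \<rightarrow>\<^sub>E V. card {k\<in>?J. f k \<in> ?N} < (p - \<epsilon>) * card ?J}"
      have finB: "finite ?B" using finI finV finite_PiE[of ?J "\<lambda>_. V"] by simp
      have "inj_on (\<lambda>f. restrict f ?J) (Q xy)"
      proof (rule inj_onI)
        fix f g assume fg: "f \<in> Q xy" "g \<in> Q xy" "restrict f ?J = restrict g ?J"
        have "f k = g k" if "k \<in> I" for k
          using fun_cong[OF fg(3), of k] fg(1,2) that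
          by (cases "k = i \<or> k = j") (auto simp: Q_def xy_eq)
        then show "f = g"
          using fg(1,2) by (intro PiE_ext[of f I "\<lambda>_. V"]) (auto simp: Q_def Poor_def xy_eq)
      qed
      moreover have "(\<lambda>f. restrict f ?J) ` Q xy \<subseteq> ?B"
      proof
        fix g assume "g \<in> (\<lambda>f. restrict f ?J) ` Q xy"
        then obtain f where f: "f \<in> Q xy" "g = restrict f ?J" by blast
        have "{k\<in>?J. g k \<in> ?N} = {k\<in>?J. f k \<in> ?N}" using f(2) by auto
        then have "card {k\<in>?J. g k \<in> ?N} < (p - \<epsilon>) * card ?J"
          using f(1) by (auto simp: Q_def xy_eq Poor_def hits_def cJ)
        moreover have "g \<in> ?J \<rightarrow>\<^sub>E V" using f by (auto simp: Q_def xy_eq Poor_def)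
        ultimately show "g \<in> ?B" by blast
      qed
      ultimately have "card (Q xy) \<le> card ?B" using finB by (intro card_inj_on_le)
      moreover have "card ?B \<le> real (card V) ^ card ?J * exp (- \<epsilon>\<^sup>2 / 4 * card ?J)"
      proof (rule card_PiE_few_hits_le)
        show "?N \<subseteq> V" using link_subset[OF G] by (auto simp: V_def)
        have "d \<le> card ?N"
          using d[of x y] xy' unfolding V_def codegree_eq_card_link[OF G xy'(3)] by blast
        then show "p * card V \<le> card ?N" using n cV by (simp add: p_def)
      qed (use finI finV p \<epsilon> in auto)
      ultimately show ?thesis using cJ cV by (simp add: order_trans)
    qed
    have "Poor i j \<subseteq> (\<Union>xy\<in>V \<times> V. Q xy)" using ij by (auto simp: Poor_def Q_def)
    moreover have "finite (Q xy)" for xy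
      using fin\<Omega> by (rule rev_finite_subset) (auto simp: Q_def Poor_def split: prod.splits)
    ultimately have "card (Poor i j) \<le> card (\<Union>xy\<in>V \<times> V. Q xy)"
      using finV by (intro card_mono) auto
    also have "\<dots> \<le> (\<Sum>xy\<in>V \<times> V. card (Q xy))" using finV by (intro card_UN_le) auto
    finally have "card (Poor i j) \<le> (\<Sum>xy\<in>V \<times> V. real (card (Q xy)))"
      unfolding of_nat_sum[symmetric] of_nat_le_iff .
    also have "\<dots> \<le> (\<Sum>xy\<in>V \<times> V. n ^ (m - 2) * ?e)" by (intro sum_mono Q)
    also have "\<dots> = n ^ 2 * n ^ (m - 2) * ?e"
      by (simp add: card_cartesian_product cV power2_eq_square)
    also have "n ^ 2 * n ^ (m - 2) = n ^ m"
      by (simp only: power_add[symmetric] le_add_diff_inverse[OF m])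
    finally show ?thesis by simp
  qed
  let ?P = "{(i, j). i \<in> I \<and> j \<in> I \<and> i \<noteq> j}"
  have PI: "?P \<subseteq> I \<times> I" by auto
  have finP: "finite ?P" using finite_subset[OF PI] finI by blast
  have cP: "real (card ?P) \<le> m\<^sup>2"
    using card_mono[OF _ PI] finI cI
    by (simp add: card_cartesian_product power2_eq_square flip: of_nat_mult)
  \<comment> \<open>Otherwise at most \<open>m\<^sup>2\<close> pairs account for all
    \<open>n ^ m\<close> maps, each for at most \<open>n ^ m * (1 / n + ?e)\<close> of them, which
    contradicts \<open>small\<close>.\<close>
  have "\<exists>f\<in>?\<Omega>. \<forall>(i, j)\<in>?P. f \<notin> Coll i j \<union> Poor i j"
  proof (rule ccontr)
    assume "\<not> ?thesis"
    then have "?\<Omega> \<subseteq> (\<Union>(i, j)\<in>?P. Coll i j \<union> Poor i j)" by blast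
    moreover have "finite (\<Union>(i, j)\<in>?P. Coll i j \<union> Poor i j)"
      using fin\<Omega> by (rule rev_finite_subset) (auto simp: Coll_def Poor_def)
    ultimately have "card ?\<Omega> \<le> card (\<Union>(i, j)\<in>?P. Coll i j \<union> Poor i j)"
      by (intro card_mono)
    also have "\<dots> \<le> (\<Sum>(i, j)\<in>?P. card (Coll i j \<union> Poor i j))"
      using card_UN_le[OF finP, of "\<lambda>(i, j). Coll i j \<union> Poor i j"]
      by (simp add: case_prod_beta)
    also have "\<dots> \<le> (\<Sum>(i, j)\<in>?P. card (Coll i j) + card (Poor i j))"
      by (intro sum_mono) (auto intro: card_Un_le)
    finally have "real (n ^ m) \<le> (\<Sum>(i, j)\<in>?P. real (card (Coll i j)) + card (Poor i j))"
      unfolding c\<Omega> of_nat_le_iff[where 'a = real, symmetric] by (simp add: case_prod_beta)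
    also have "\<dots> \<le> (\<Sum>(i, j)\<in>?P. n ^ m / n + n ^ m * ?e)"
    proof (intro sum_mono, clarify)
      fix i j assume ij: "i \<in> I" "j \<in> I" "i \<noteq> j"
      have "real (card (Coll i j)) \<le> real (n ^ (m - 1))" using Coll[OF ij] by (rule of_nat_mono)
      also have "\<dots> = n ^ m / n" using n m by (cases m) auto
      finally show "real (card (Coll i j)) + card (Poor i j) \<le> n ^ m / n + n ^ m * ?e"
        using Poor[OF ij] by simp
    qed
    also have "\<dots> = card ?P * (n ^ m / n + n ^ m * ?e)" by (simp add: case_prod_beta)
    also have "\<dots> \<le> m\<^sup>2 * (n ^ m / n + n ^ m * ?e)" using cP by (intro mult_right_mono) auto
    also have "\<dots> = n ^ m * (m\<^sup>2 / n + m\<^sup>2 * ?e)" by (simp add: algebra_simps)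
    also have "\<dots> < real (n ^ m) * 1" using small n by (intro mult_strict_left_mono) auto
    finally show False by simp
  qed
  then obtain f where f: "f \<in> ?\<Omega>"
    and good: "\<And>i j. i \<in> I \<Longrightarrow> j \<in> I \<Longrightarrow> i \<noteq> j \<Longrightarrow> f \<notin> Coll i j \<union> Poor i j"
    by blast
  have inj: "inj_on f I" using good f by (intro inj_onI) (auto simp: Coll_def)
  show ?thesis
  proof (rule that[of "f ` I"])
    show "f ` I \<subseteq> verts G" using f by (auto simp: V_def)
    show "card (f ` I) = m" using inj cI by (simp add: card_image)
    fix u v assume uv: "u \<in> f ` I" "v \<in> f ` I" "u \<noteq> v"
    then obtain i j where ij: "i \<in> I" "j \<in> I" "u = f i" "v = f j" "i \<noteq> j" by auto
    have "(p - \<epsilon>) * real (m - 2) \<le> hits f i j"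
      using good[OF ij(1,2,5)] f uv(3) ij by (auto simp: Poor_def)
    \<comment> \<open>Injectivity of \<open>f\<close> turns hitting indices into equally many
      vertices of the sample.\<close>
    also have "hits f i j = card (f ` {k \<in> I - {i, j}. f k \<in> link G u v})"
      unfolding hits_def ij by (intro card_image[symmetric] inj_on_subset[OF inj]) auto
    also have "\<dots> \<le> card (link G u v \<inter> f ` I)"
      using finI by (intro card_mono) auto
    finally show "(d / n - \<epsilon>) * real (m - 2) \<le> card (link G u v \<inter> f ` I)" by (simp add: p_def)
  qed
qed

text \<open>A sample of \<open>m\<close> vertices from an extremal host on \<open>n\<close> vertices
  induces an \<open>F\<close>-free 3-graph with nearly the same relative codegrees, which bounds
  \<open>coex m {F}\<close> from below.\<close>

lemma coex_ratio_almost_decreasing: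
  assumes F: "edges F \<noteq> {}" and \<epsilon>: "0 < \<epsilon>"
  shows "\<exists>m0. \<forall>m\<ge>m0. \<exists>n0. \<forall>n\<ge>n0.
           real (coex n {F}) / (real n - 2) \<le> real (coex m {F}) / (real m - 2) + \<epsilon>"
proof -
  \<comment> \<open>One half of \<open>\<epsilon>\<close> pays for the sampling, the other for
    passing between the denominators \<open>n\<close> and \<open>n - 2\<close>.\<close>
  define \<delta> where "\<delta> = \<epsilon> / 2"
  have \<delta>: "\<delta> > 0" using \<epsilon> by (simp add: \<delta>_def)
  have "(\<lambda>m::nat. real m ^ 2 * exp (- \<delta>\<^sup>2 / 4 * (real m - 2))) \<longlonglongrightarrow> 0"
    using \<delta> by real_asymp
  then have "\<forall>\<^sub>F m in sequentially. real m ^ 2 * exp (- \<delta>\<^sup>2 / 4 * (real m - 2)) < 1 / 2"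
    by (rule order_tendstoD) simp
  then obtain m0 where m0: "\<And>m. m \<ge> m0 \<Longrightarrow> real m ^ 2 * exp (- \<delta>\<^sup>2 / 4 * (real m - 2)) < 1 / 2"
    by (auto simp: eventually_sequentially)
  show ?thesis
  proof (intro exI allI impI)
    fix m assume m: "m \<ge> max m0 3"
    \<comment> \<open>\<open>n > 2 * m\<^sup>2\<close> keeps the collision term below 1/2, and
      \<open>n \<ge> 2 / \<delta>\<close> controls the change of denominator.\<close>
    fix n assume n: "n \<ge> max (2 * m\<^sup>2 + 3) (nat \<lceil>2 / \<delta>\<rceil>)"
    have m3: "m \<ge> 3" and n3: "n \<ge> 3" using m n by auto
    have ndelta: "2 / real n \<le> \<delta>"
    proof -
      have "2 / \<delta> \<le> n" using n by linarith
      then show ?thesis using \<delta> n3 by (simp add: field_simps)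
    qed
    define d where "d = coex n {F}"
    have dn: "d \<le> n - 2" unfolding d_def using coex_le[OF F] n3 by simp
    have n2: "2 \<le> n" "2 \<le> m" using n3 m3 by auto
    obtain G where G: "codegree_host F n d G"
      using coex_attained[OF F n2(1)] unfolding d_def by blast
    have tG: "three_graph G" using G by (simp add: codegree_host_def)
    have small: "real (m\<^sup>2) / n + real (m\<^sup>2) * exp (- \<delta>\<^sup>2 / 4 * real (m - 2)) < 1"
    proof -
      have "2 * m\<^sup>2 < n" using n by simp
      then have "2 * real (m\<^sup>2) < real n" by linarith
      then have "m\<^sup>2 / n < (1 / 2 :: real)" using n3 by (simp add: field_simps)
      moreover have "m\<^sup>2 * exp (- \<delta>\<^sup>2 / 4 * real (m - 2)) < (1 / 2 :: real)"
        using m0[of m] m by (simp add: of_nat_diff)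
      ultimately show ?thesis by linarith
    qed
    obtain W where W: "W \<subseteq> verts G" "card W = m"
      "\<And>u v. u \<in> W \<Longrightarrow> v \<in> W \<Longrightarrow> u \<noteq> v \<Longrightarrow> (d / n - \<delta>) * real (m - 2) \<le> card (link G u v \<inter> W)"
    proof (rule exists_dense_sample[OF tG _ _ _ _ \<delta> n2(2) small])
      show "card (verts G) = n" "0 < n" "d \<le> n" using G n3 dn by (auto simp: codegree_host_def)
      show "d \<le> codegree G u v" if "u \<in> verts G" "v \<in> verts G" "u \<noteq> v" for u v
        using G that by (simp add: codegree_host_def)
    qed blast
    \<comment> \<open>Codegrees are natural numbers, so the real bound may be rounded up; a negative
      bound becomes 0.\<close>
    define d' where "d' = nat \<lceil>(d / n - \<delta>) * real (m - 2)\<rceil>"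
    have "codegree_host F m d' (induced G W)"
      unfolding codegree_host_def
    proof (intro conjI ballI impI)
      show "three_graph (induced G W)" using three_graph_induced[OF tG W(1)] .
      show "card (verts (induced G W)) = m" using W by (simp add: induced_def)
      show "\<not> contains (induced G W) F"
        using G contains_induced[OF _ W(1)] by (auto simp: codegree_host_def)
      fix u v assume "u \<in> verts (induced G W)" "v \<in> verts (induced G W)" "u \<noteq> v"
      then have uv: "u \<in> W" "v \<in> W" "u \<noteq> v" by (simp_all add: induced_def)
      have "d' \<le> card (link G u v \<inter> W)"
        using W(3)[OF uv] unfolding d'_def by linarith
      then show "d' \<le> codegree (induced G W) u v" using codegree_induced[OF tG W(1) uv] by simp
    qed
    then have "d' \<le> coex m {F}" using n2(2) by (rule coex_ge)
    then have "(d / n - \<delta>) * real (m - 2) \<le> coex m {F}" unfolding d'_def by linarith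
    then have "d / n - \<delta> \<le> coex m {F} / (real m - 2)"
      using m3 by (simp add: field_simps of_nat_diff)
    \<comment> \<open>The two fractions differ by \<open>2 * d / (n * (n - 2))\<close>, and
      \<open>d \<le> n - 2\<close>.\<close>
    moreover have "d / (real n - 2) \<le> d / n + 2 / n"
    proof -
      have "real d \<le> real n - 2" using dn n3 by linarith
      then show ?thesis using n3 by (simp add: field_simps)
    qed
    ultimately show "real (coex n {F}) / (real n - 2) \<le> real (coex m {F}) / (real m - 2) + \<epsilon>"
      using ndelta unfolding d_def \<delta>_def by linarith
  qed
qed

lemma coex_ratio_bounds:
  assumes "edges F \<noteq> {}" "n \<ge> 3"
  shows "0 \<le> real (coex n {F}) / (real n - 2)" "real (coex n {F}) / (real n - 2) \<le> 1"
proof -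
  have "coex n {F} \<le> n - 2" using coex_le[OF assms(1)] assms(2) by simp
  then have "real (coex n {F}) \<le> real n - 2" using assms(2) by linarith
  then show "0 \<le> real (coex n {F}) / (real n - 2)" "real (coex n {F}) / (real n - 2) \<le> 1"
    using assms(2) by simp_all
qed

lemma coex_ratio_tendsto:
  assumes F: "edges F \<noteq> {}"
  shows "(\<lambda>n. real (coex n {F}) / (real n - 2)) \<longlonglongrightarrow> codegree_density {F}"
proof -
  \<comment> \<open>The ratio is controlled only from 3 on, its denominator being zero at 2;
    boundedness ignores an initial segment.\<close>
  have "Bseq (\<lambda>n. real (coex (n + 3) {F}) / (real (n + 3) - 2))"
  proof (rule BseqI'[of _ 1])
    show "norm (real (coex (n + 3) {F}) / (real (n + 3) - 2)) \<le> 1" for n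
      using coex_ratio_bounds[OF F, of "n + 3"] unfolding real_norm_def by linarith
  qed
  then have "Bseq (\<lambda>n. real (coex n {F}) / (real n - 2))"
    by (rule Bseq_offset[where k = 3])
  then have "convergent (\<lambda>n. real (coex n {F}) / (real n - 2))"
    using coex_ratio_almost_decreasing[OF F] by (rule convergent_if_almost_decreasing)
  then show ?thesis unfolding codegree_density_def by (simp add: convergent_LIMSEQ_iff)
qed

lemma codegree_density_le_1: "edges F \<noteq> {} \<Longrightarrow> codegree_density {F} \<le> 1"
  by (rule LIMSEQ_le_const2[OF coex_ratio_tendsto]) (use coex_ratio_bounds in blast)+

section \<open>The inequality between the densities\<close>

text \<open>Here \<open>s\<close> is the size of the link \<open>W\<close> of some pair in an
  extremal host. Inclusion-exclusion for \<open>W\<close> and the link of a sparse pair in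
  \<open>W\<close> gives the second bound; \<open>2 \<le> coex n {co_spanned H}\<close> ensures that
  \<open>W\<close> contains a pair.\<close>

lemma coex_co_spanned_le:
  assumes H: "three_graph H" "edges H \<noteq> {}" and n: "2 \<le> n" and "2 \<le> coex n {co_spanned H}"
  obtains s where "coex n {co_spanned H} \<le> s"
    "coex n {co_spanned H} + s \<le> n + coex s {H}"
proof -
  define d where "d = coex n {co_spanned H}"
  have "edges (co_spanned H) \<noteq> {}" using H by (simp add: co_spanned_def)
  then obtain G where G: "codegree_host (co_spanned H) n d G"
    using coex_attained n unfolding d_def by metis
  have tG: "three_graph G" and cG: "card (verts G) = n"
    using G by (simp_all add: codegree_host_def)
  have dG: "d \<le> card (link G u v)" if "u \<in> verts G" "v \<in> verts G" "u \<noteq> v" for u v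
    using G that unfolding codegree_host_def codegree_eq_card_link[OF tG that(3), symmetric] by blast
  have finG: "finite (verts G)" using tG by (simp add: three_graph_def)
  obtain x y where xy: "x \<in> verts G" "y \<in> verts G" "x \<noteq> y"
    using n cG card_le_Suc0_iff_eq[OF finG] by force
  define W where "W = link G x y"
  have W: "W \<subseteq> verts G" using link_subset[OF tG] by (auto simp: W_def)
  have dW: "d \<le> card W" using dG[OF xy] by (simp add: W_def)
  have "\<not> contains (induced G W) H"
    using contains_co_spanned[OF tG _ xy H(1)] G by (auto simp: W_def codegree_host_def)
  then obtain u v where uv: "u \<in> W" "v \<in> W" "u \<noteq> v" and
    sparse: "card (link G u v \<inter> W) \<le> coex (card W) {H}"
    using exists_sparse_pair[OF H(2) tG W] dW assms(4) unfolding d_def by (metis order_trans)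
  have "card (link G u v) + card W = card (link G u v \<union> W) + card (link G u v \<inter> W)"
    using finite_link[OF tG] by (intro card_Un_Int) (auto simp: W_def)
  moreover have "card (link G u v \<union> W) \<le> n"
    unfolding cG[symmetric] using link_subset[OF tG, of u v] W finG by (intro card_mono) auto
  moreover have "d \<le> card (link G u v)" using dG uv W by blast
  ultimately have "d + card W \<le> n + coex (card W) {H}" using sparse by linarith
  then show ?thesis using that dW unfolding d_def by blast
qed

text \<open>A \<open>g\<close> strictly above the density exceeds
  \<open>coex s {H} / (s - 2)\<close> for all large \<open>s\<close>, so the finite inequality can
  be used with \<open>g\<close> in place of the limit.\<close>

lemma codegree_density_co_spanned_mult_le:
  assumes H: "three_graph H" "edges H \<noteq> {}" and g: "codegree_density {H} < g" "g \<le> 1"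
  shows "codegree_density {co_spanned H} * (2 - g) \<le> 1"
proof -
  have "edges (co_spanned H) \<noteq> {}" using H by (simp add: co_spanned_def)
  note lim = coex_ratio_tendsto[OF this]
  obtain s0 where s0: "\<And>s. s \<ge> s0 \<Longrightarrow> real (coex s {H}) / (real s - 2) < g"
    using order_tendstoD(2)[OF coex_ratio_tendsto[OF H(2)] g(1)] by (auto simp: eventually_sequentially)
  \<comment> \<open>Some non-negative ratio lies below \<open>g\<close>.\<close>
  have g0: "0 \<le> g"
    by (rule order_trans[OF coex_ratio_bounds(1)[OF H(2), of "max s0 3"] less_imp_le[OF s0]]) simp_all
  \<comment> \<open>Covers the case of small \<open>coex n {co_spanned H}\<close>, where
    \<open>2 - g \<le> 2\<close>; it vanishes after division by \<open>n - 2\<close>.\<close>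
  define K where "K = 2 * real (s0 + 3)"
  have bound: "coex n {co_spanned H} * (2 - g) \<le> real n + K" if n: "2 \<le> n" for n
  proof (cases "coex n {co_spanned H} \<ge> s0 + 3")
    case True
    \<comment> \<open>The threshold \<open>s0 + 3\<close> first provides the required
      \<open>2 \<le> coex n {co_spanned H}\<close>, then gives \<open>s \<ge> s0\<close> and makes
      \<open>s - 2\<close> positive.\<close>
    then obtain s where s: "coex n {co_spanned H} \<le> s" "coex n {co_spanned H} + s \<le> n + coex s {H}"
      using coex_co_spanned_le[OF H n] by auto
    have s3: "s \<ge> s0" "s \<ge> 3" using s(1) True by auto
    have "coex s {H} < g * (real s - 2)" using s0[OF s3(1)] s3(2) by (simp add: field_simps)
    also have "\<dots> \<le> g * s" using g0 by (intro mult_left_mono) auto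
    finally have "coex n {co_spanned H} + (1 - g) * s \<le> n"
      using s(2) by (simp add: algebra_simps)
    \<comment> \<open>Since \<open>1 - g\<close> is non-negative, \<open>s\<close> may be replaced
      by its lower bound.\<close>
    moreover have "(1 - g) * coex n {co_spanned H} \<le> (1 - g) * s"
      using s(1) g(2) by (intro mult_left_mono) auto
    ultimately show ?thesis by (simp add: algebra_simps K_def)
  next
    case False
    then have "coex n {co_spanned H} * (2 - g) \<le> real (s0 + 3) * 2"
      using g0 g(2) by (intro mult_mono) auto
    then show ?thesis by (simp add: K_def)
  qed
  have "(\<lambda>n. real (coex n {co_spanned H}) / (real n - 2) * (2 - g))
          \<longlonglongrightarrow> codegree_density {co_spanned H} * (2 - g)"
    by (intro tendsto_mult lim tendsto_const)
  moreover have "(\<lambda>n. (real n + K) / (real n - 2)) \<longlonglongrightarrow> 1" by real_asymp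
  moreover have "\<forall>\<^sub>F n in sequentially.
      real (coex n {co_spanned H}) / (real n - 2) * (2 - g) \<le> (real n + K) / (real n - 2)"
    using eventually_ge_at_top[of 3]
    by eventually_elim (use bound in \<open>auto intro!: divide_right_mono\<close>)
  ultimately show ?thesis by (intro tendsto_le[OF sequentially_bot])
qed

theorem proposition18:
  fixes H :: "'a hypergraph"
  assumes "three_graph H" and "edges H \<noteq> {}"
  shows "codegree_density {co_spanned H} \<le> 1 / (2 - codegree_density {H})"
proof (cases "codegree_density {H} = 1")
  \<comment> \<open>No \<open>g\<close> with \<open>codegree_density {H} < g\<close> and
    \<open>g \<le> 1\<close> exists here, but the right side is 1 and the trivial bound
    suffices.\<close>
  case True
  have "edges (co_spanned H) \<noteq> {}" using assms by (simp add: co_spanned_def)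
  then show ?thesis using True codegree_density_le_1 by simp
next
  case False
  let ?\<gamma> = "codegree_density {H}"
  let ?c = "codegree_density {co_spanned H}"
  have lt: "?\<gamma> < 1" using False codegree_density_le_1[OF assms(2)] by simp
  \<comment> \<open>Let \<open>g\<close> decrease to the density of \<open>H\<close>, staying below
    1.\<close>
  have "((\<lambda>g. ?c * (2 - g)) \<longlongrightarrow> ?c * (2 - ?\<gamma>)) (at_right ?\<gamma>)"
    by (intro tendsto_intros)
  moreover have "\<forall>\<^sub>F g in at_right ?\<gamma>. ?c * (2 - g) \<le> 1"
    using eventually_at_right_real[OF lt]
    by eventually_elim (use codegree_density_co_spanned_mult_le[OF assms] in auto)
  ultimately have "?c * (2 - ?\<gamma>) \<le> 1"
    by (intro tendsto_upperbound) auto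
  then show ?thesis using lt by (simp add: field_simps)
qed

end
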